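(* Let $A=\{a_{ij}\}$, $i=1,2,\ldots$, $j=0,1,2,\ldots$, be a double sequence of complex scalars satisfying $A\in B_c$, and let $g(z)=\sum_{i=0}^{\infty} g_i z^i$ be a complex power series. For $z\in\mathbb{C}$ put $P^{C}_{A;g}(z)=\{a_{ij}\,g_i\,z^{i}\}$. If $P^{C}_{A;g}(a)\in B_c$ for some complex number $a\neq 0$, then $P^{C}_{A;g}(z)\in B_c$ for all complex $z$ satisfying $|z|<|a|$.
   Context: Let $c$ be the space of convergent sequences of complex scalars (with the supremum norm) and $B_c$ the space of bounded linear maps of $c$ into $c$. A double sequence $B=\{b_{ij}\}$, $i=1,2,\ldots$, $j=0,1,2,\ldots$, of complex constants acts on $s=[s_1,s_2,\ldots]\in c$ by $B(s)_i=b_{i0}\lim_{k\to\infty}s_k+\sum_{j=1}^{\infty}b_{ij}s_j$, $i=1,2,\ldots$. One writes $B\in B_c$ if this defines a bounded linear map of $c$ into $c$; equivalently, if (1) $\sup_{i}\sum_{j=0}^{\infty}|b_{ij}|<\infty$; (2) $\lim_{i\to\infty}b_{ij}$ exists for $j=1,2,\ldots$; (3) $\lim_{i\to\infty}\sum_{j=0}^{\infty}b_{ij}$ exists. *)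

theory Defs
  imports Complex_Main "HOL-Computational_Algebra.Formal_Power_Series"
begin

(* A sequence [s_1, s_2, ...] is a function s with s k standing for s_{k+1}. *)

definition conv_seqs :: "(nat \<Rightarrow> complex) set" where
  "conv_seqs = {s. convergent s}"

definition sup_norm :: "(nat \<Rightarrow> complex) \<Rightarrow> real" where
  "sup_norm s = (SUP k. norm (s k))"

(* Bounded complex-linear maps of conv_seqs into itself; values outside conv_seqs are irrelevant. *)
definition Bc :: "((nat \<Rightarrow> complex) \<Rightarrow> (nat \<Rightarrow> complex)) set" where
  "Bc = {T. (\<forall>s\<in>conv_seqs. T s \<in> conv_seqs) \<and>
            (\<forall>s\<in>conv_seqs. \<forall>t\<in>conv_seqs. T (\<lambda>k. s k + t k) = (\<lambda>i. T s i + T t i)) \<and>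
            (\<forall>c. \<forall>s\<in>conv_seqs. T (\<lambda>k. c * s k) = (\<lambda>i. c * T s i)) \<and>
            (\<exists>K. \<forall>s\<in>conv_seqs. sup_norm (T s) \<le> K * sup_norm s)}"

(* Double sequences B i j keep their original indices i = 1, 2, ... and j = 0, 1, 2, ...;
   row 0 is never used. *)

definition matrix_map :: "(nat \<Rightarrow> nat \<Rightarrow> complex) \<Rightarrow> (nat \<Rightarrow> complex) \<Rightarrow> nat \<Rightarrow> complex" where
  "matrix_map B s = (\<lambda>i. B (Suc i) 0 * lim s + (\<Sum>j. B (Suc i) (Suc j) * s j))"

(* Convergence of the row series is required explicitly because suminf is total. *)
definition matrix_in_Bc :: "(nat \<Rightarrow> nat \<Rightarrow> complex) \<Rightarrow> bool" where
  "matrix_in_Bc B \<longleftrightarrow>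
     (\<forall>s\<in>conv_seqs. \<forall>i. summable (\<lambda>j. B (Suc i) (Suc j) * s j)) \<and> matrix_map B \<in> Bc"

definition P_C :: "(nat \<Rightarrow> nat \<Rightarrow> complex) \<Rightarrow> complex fps \<Rightarrow> complex \<Rightarrow> nat \<Rightarrow> nat \<Rightarrow> complex" where
  "P_C A g z = (\<lambda>i j. A i j * fps_nth g i * z ^ i)"

end

theory Submission
  imports Defs
begin

text \<open>
  Passing from \<open>a\<close> to \<open>z\<close> multiplies row \<open>i\<close> of the double sequence by \<open>(z / a) ^ i\<close>, so the new
  map is the old one followed by multiplication with the null sequence \<open>(z / a) ^ i\<close>. Multiplication
  with a fixed convergent sequence is itself a bounded linear map of the space of convergent
  sequences into itself, whence the composition is again bounded (\<open>matrix_in_Bc_scale_rows\<close>).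
\<close>

lemma norm_le_sup_norm:
  assumes "s \<in> conv_seqs"
  shows "norm (s k) \<le> sup_norm s"
proof -
  have "bdd_above (range (\<lambda>k. norm (s k)))"
    using assms by (auto simp: conv_seqs_def intro!: bdd_aboveI2 dest!: convergent_imp_Bseq elim!: BseqE)
  thus ?thesis
    unfolding sup_norm_def by (rule cSUP_upper2) auto
qed

lemma Bc_mult_convergent:
  assumes T: "T \<in> Bc" and r: "convergent r"
  shows "(\<lambda>s i. r i * T s i) \<in> Bc"
proof -
  from T obtain K where K: "\<And>s. s \<in> conv_seqs \<Longrightarrow> sup_norm (T s) \<le> K * sup_norm s"
    unfolding Bc_def by blast
  from r obtain M where M: "0 < M" "\<And>i. norm (r i) \<le> M"
    by (metis convergent_imp_Bseq BseqE)
  have closed: "T s \<in> conv_seqs" if "s \<in> conv_seqs" for s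
    using T that by (auto simp: Bc_def)
  have "sup_norm (\<lambda>i. r i * T s i) \<le> M * K * sup_norm s" if s: "s \<in> conv_seqs" for s
    unfolding sup_norm_def[of "\<lambda>i. r i * T s i"]
  proof (rule cSUP_least)
    fix i :: nat
    have "norm (r i * T s i) \<le> M * sup_norm (T s)"
      unfolding norm_mult using M norm_le_sup_norm[OF closed[OF s]] by (intro mult_mono) auto
    also have "\<dots> \<le> M * (K * sup_norm s)"
      using M K[OF s] by simp
    finally show "norm (r i * T s i) \<le> M * K * sup_norm s"
      by (simp add: mult.assoc)
  qed simp
  hence "\<exists>L. \<forall>s\<in>conv_seqs. sup_norm (\<lambda>i. r i * T s i) \<le> L * sup_norm s"
    by blast
  moreover have "(\<lambda>i. r i * T s i) \<in> conv_seqs" if "s \<in> conv_seqs" for s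
    using closed[OF that] r by (auto simp: conv_seqs_def intro: convergent_mult)
  ultimately show ?thesis
    using T by (auto simp: Bc_def algebra_simps)
qed

text \<open>
  Two maps that agree on convergent sequences may differ elsewhere. This matters because a factor
  can be pulled out of a row series only where that series converges.
\<close>

lemma Bc_cong:
  assumes "T \<in> Bc" and eq: "\<And>s. s \<in> conv_seqs \<Longrightarrow> U s = T s"
  shows "U \<in> Bc"
proof -
  have "(\<lambda>k. s k + t k) \<in> conv_seqs" if "s \<in> conv_seqs" "t \<in> conv_seqs" for s t
    using that by (auto simp: conv_seqs_def intro: convergent_add)
  moreover have "(\<lambda>k. c * s k) \<in> conv_seqs" if "s \<in> conv_seqs" for c s
    using that by (auto simp: conv_seqs_def intro: convergent_mult convergent_const)
  ultimately show ?thesis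
    using assms by (simp add: Bc_def)
qed

lemma matrix_in_Bc_scale_rows:
  assumes B: "matrix_in_Bc B" and r: "convergent r"
  shows "matrix_in_Bc (\<lambda>i j. r i * B i j)"
proof -
  have summable: "summable (\<lambda>j. B (Suc i) (Suc j) * s j)" if "s \<in> conv_seqs" for s i
    using B that by (simp add: matrix_in_Bc_def)
  have "convergent (\<lambda>i. r (Suc i))"
    using r by (simp add: convergent_Suc_iff)
  with B have "(\<lambda>s i. r (Suc i) * matrix_map B s i) \<in> Bc"
    by (intro Bc_mult_convergent) (simp_all add: matrix_in_Bc_def)
  hence "matrix_map (\<lambda>i j. r i * B i j) \<in> Bc"
  proof (rule Bc_cong)
    fix s assume s: "s \<in> conv_seqs"
    show "matrix_map (\<lambda>i j. r i * B i j) s = (\<lambda>i. r (Suc i) * matrix_map B s i)"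
      using summable[OF s] by (simp add: matrix_map_def distrib_left mult.assoc suminf_mult)
  qed
  with summable show ?thesis
    by (simp add: matrix_in_Bc_def mult.assoc summable_mult)
qed

theorem proposition2:
  fixes A :: "nat \<Rightarrow> nat \<Rightarrow> complex" and g :: "complex fps" and a :: complex
  assumes "matrix_in_Bc A"
    and "a \<noteq> 0"
    and "matrix_in_Bc (P_C A g a)"
  shows "\<forall>z::complex. norm z < norm a \<longrightarrow> matrix_in_Bc (P_C A g z)"
proof (intro allI impI)
  fix z :: complex
  assume "norm z < norm a"
  hence "norm (z / a) < 1"
    by (simp add: norm_divide divide_less_eq)
  hence "convergent (\<lambda>i. (z / a) ^ i)"
    by (metis LIMSEQ_power_zero convergentI)
  with assms(3) have "matrix_in_Bc (\<lambda>i j. (z / a) ^ i * P_C A g a i j)"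
    by (rule matrix_in_Bc_scale_rows)
  moreover have "(\<lambda>i j. (z / a) ^ i * P_C A g a i j) = P_C A g z"
    using \<open>a \<noteq> 0\<close> by (simp add: P_C_def power_divide fun_eq_iff)
  ultimately show "matrix_in_Bc (P_C A g z)"
    by simp
qed

end
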